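(* Let $m,L,U$ be integers with $1\le L\le U\le m$. There is a one-to-one correspondence (bijection) between the set of composite alternatives $\Omega^{[L,U]}$ and the set of directed paths from $p^0_0$ to $d$ in the MuC DAG.
   Context: $\Omega^{[L,U]}=\{S\subseteq\{1,\dots,m\}: L\le |S|\le U\}$. MuC DAG: nodes are $p^0_0$, $p^c_j$ with $1\le c\le U$, $c\le j\le m$, and a destination $d$. Arcs are: $p^c_j\to p^{c+1}_{j'}$ for every $j'$ with $j<j'\le m$ whenever both are nodes; $p^c_j\to d$ whenever $L\le c\le U$. *)

theory Defs
  imports "Graph_Theory.Graph_Theory"
begin

definition composite_alternatives :: "nat \<Rightarrow> nat \<Rightarrow> nat \<Rightarrow> nat set set" where
  "composite_alternatives m L U = {S. S \<subseteq> {1..m} \<and> L \<le> card S \<and> card S \<le> U}"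

(* P c j stands for p^c_j: the superscript comes first. *)
datatype muc_node = P nat nat | Dest

definition muc_nodes :: "nat \<Rightarrow> nat \<Rightarrow> muc_node set" where
  "muc_nodes m U =
     {P 0 0} \<union> {P c j | c j. 1 \<le> c \<and> c \<le> U \<and> c \<le> j \<and> j \<le> m} \<union> {Dest}"

definition muc_arcs :: "nat \<Rightarrow> nat \<Rightarrow> nat \<Rightarrow> (muc_node \<times> muc_node) set" where
  "muc_arcs m L U =
     {(P c j, P (c + 1) j') | c j j'.
        j < j' \<and> j' \<le> m \<and> P c j \<in> muc_nodes m U \<and> P (c + 1) j' \<in> muc_nodes m U}
   \<union> {(P c j, Dest) | c j. L \<le> c \<and> c \<le> U \<and> P c j \<in> muc_nodes m U}"

definition muc_dag :: "nat \<Rightarrow> nat \<Rightarrow> nat \<Rightarrow> muc_node pair_pre_digraph" where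
  "muc_dag m L U = \<lparr> pverts = muc_nodes m U, parcs = muc_arcs m L U \<rparr>"

(* A path is the list of its arcs, as in the library; since the graph has no
   parallel arcs and both end points are fixed, this determines, and is
   determined by, its sequence of nodes. *)
definition muc_paths :: "nat \<Rightarrow> nat \<Rightarrow> nat \<Rightarrow> (muc_node \<times> muc_node) list set" where
  "muc_paths m L U = {p. pre_digraph.apath (with_proj (muc_dag m L U)) (P 0 0) p Dest}"

lemma acyclic_muc_arcs: "acyclic (muc_arcs m L U)"
proof -
  have "muc_arcs m L U \<subseteq> measure (case_muc_node (\<lambda>c j. c) (Suc U))"
    by (auto simp: muc_arcs_def)
  then show ?thesis
    using acyclic_subset[OF wf_acyclic[OF wf_measure]] by blast
qed

lemma pair_digraph_muc_dag: "pair_digraph (muc_dag m L U)"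
proof
  have "muc_nodes m U \<subseteq> (\<lambda>(c, j). P c j) ` ({0..U} \<times> {0..m}) \<union> {Dest}"
    by (auto simp: muc_nodes_def)
  then have fin: "finite (muc_nodes m U)"
    by (rule finite_subset) simp
  have "Dest \<in> muc_nodes m U"
    by (simp add: muc_nodes_def)
  then have arcs: "muc_arcs m L U \<subseteq> muc_nodes m U \<times> muc_nodes m U"
    unfolding muc_arcs_def by blast
  show "finite (pverts (muc_dag m L U))" "finite (parcs (muc_dag m L U))"
    using fin finite_subset[OF arcs finite_cartesian_product[OF fin fin]]
    by (simp_all add: muc_dag_def)
  fix e assume e: "e \<in> parcs (muc_dag m L U)"
  then show "fst e \<in> pverts (muc_dag m L U)" "snd e \<in> pverts (muc_dag m L U)"
    using arcs by (cases e, auto simp: muc_dag_def)+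
  show "fst e \<noteq> snd e"
    using e by (auto simp: muc_dag_def muc_arcs_def)
qed

end

theory Submission
  imports Defs
begin

text \<open>
  A path from \<open>P 0 0\<close> to \<open>Dest\<close> is determined by the second indices of its
  intermediate nodes, because the first index counts the arcs used so far. These second
  indices form a strictly increasing list over \<open>{1..m}\<close> whose length lies between
  \<open>L\<close> and \<open>U\<close>, and such a list is the increasing enumeration of its set of entries.
\<close>

text \<open>The current node enters through the arguments \<open>c\<close> and \<open>j\<close>, so
  that walks starting at any node are covered and inductions along a walk go through.\<close>

fun muc_walk :: "nat \<Rightarrow> nat \<Rightarrow> nat list \<Rightarrow> (muc_node \<times> muc_node) list" where
  "muc_walk c j [] = [(P c j, Dest)]"
| "muc_walk c j (x # xs) = (P c j, P (c + 1) x) # muc_walk (c + 1) x xs"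

lemma muc_walk_eq_iff: "muc_walk c j xs = muc_walk c j ys \<longleftrightarrow> xs = ys"
proof (induction xs arbitrary: c j ys)
  case Nil
  then show ?case by (cases ys) auto
next
  case (Cons x xs)
  then show ?case by (cases ys) auto
qed

lemma P_in_muc_nodes_iff:
  "P c j \<in> muc_nodes m U \<longleftrightarrow> c = 0 \<and> j = 0 \<or> 1 \<le> c \<and> c \<le> U \<and> c \<le> j \<and> j \<le> m"
  by (auto simp: muc_nodes_def)

abbreviation muc_graph :: "nat \<Rightarrow> nat \<Rightarrow> nat \<Rightarrow> (muc_node, muc_node \<times> muc_node) pre_digraph" where
  "muc_graph m L U \<equiv> with_proj (muc_dag m L U)"

lemma cas_muc_walk: "pre_digraph.cas (muc_graph m L U) (P c j) (muc_walk c j xs) Dest"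
  by (induction xs arbitrary: c j) (simp_all add: pre_digraph.cas.simps)

text \<open>The arc into \<open>Dest\<close> leaves from level \<open>c + length xs\<close>, so it
  is this number that has to lie between \<open>L\<close> and \<open>U\<close>.\<close>

lemma set_muc_walk_subset_arcs:
  assumes "P c j \<in> muc_nodes m U" "sorted_wrt (<) (j # xs)" "set xs \<subseteq> {..m}"
    and "L \<le> c + length xs" "c + length xs \<le> U"
  shows "set (muc_walk c j xs) \<subseteq> muc_arcs m L U"
  using assms
proof (induction xs arbitrary: c j)
  case Nil
  then show ?case by (simp add: muc_arcs_def)
next
  case (Cons x xs)
  \<comment> \<open>Every node \<open>P c j\<close> has \<open>c \<le> j\<close>, so
    \<open>j < x\<close> gives the node condition \<open>c + 1 \<le> x\<close>.\<close>
  then have node: "P (c + 1) x \<in> muc_nodes m U"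
    by (auto simp: P_in_muc_nodes_iff)
  with Cons.prems have "(P c j, P (c + 1) x) \<in> muc_arcs m L U"
    by (simp add: muc_arcs_def)
  moreover have "set (muc_walk (c + 1) x xs) \<subseteq> muc_arcs m L U"
    using Cons.prems by (intro Cons.IH[OF node]) auto
  ultimately show ?case by simp
qed

lemma distinct_muc_walk_verts: "distinct (pre_digraph.awalk_verts (muc_graph m L U) u (muc_walk c j xs))"
proof -
  \<comment> \<open>The bound on levels strengthens the induction: what follows \<open>P c j\<close>
    is \<open>Dest\<close> or has level at least \<open>c + 1\<close>, so \<open>P c j\<close>
    cannot recur. \<open>u\<close> can be arbitrary because \<open>awalk_verts\<close> returns it
    only for an empty list of arcs, which \<open>muc_walk\<close> never is.\<close>
  have "distinct (pre_digraph.awalk_verts (muc_graph m L U) u (muc_walk c j xs)) \<and>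
    set (pre_digraph.awalk_verts (muc_graph m L U) u (muc_walk c j xs)) \<subseteq> {P c' j' | c' j'. c \<le> c'} \<union> {Dest}"
  proof (induction xs arbitrary: c j u)
    case Nil
    then show ?case by (simp add: pre_digraph.awalk_verts.simps)
  next
    case (Cons x xs)
    then show ?case by (fastforce simp: pre_digraph.awalk_verts.simps dest: Suc_leD)
  qed
  then show ?thesis ..
qed

text \<open>Decoding goes arc by arc: an arc out of \<open>P c j\<close> either ends the walk or
  supplies the next entry and raises the level by one.\<close>

lemma muc_walk_if_cas:
  assumes "P c j \<in> muc_nodes m U" "c \<le> U"
    and "pre_digraph.cas (muc_graph m L U) (P c j) p Dest" "set p \<subseteq> muc_arcs m L U"
  obtains xs where "p = muc_walk c j xs" "sorted_wrt (<) (j # xs)" "set xs \<subseteq> {..m}"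
    "L \<le> c + length xs" "c + length xs \<le> U"
proof -
  have "\<exists>xs. p = muc_walk c j xs \<and> sorted_wrt (<) (j # xs) \<and> set xs \<subseteq> {..m} \<and>
      L \<le> c + length xs \<and> c + length xs \<le> U"
    using assms
  proof (induction p arbitrary: c j)
    case Nil
    then show ?case by (simp add: pre_digraph.cas.simps)
  next
    case (Cons e p)
    then have e: "e \<in> muc_arcs m L U" "fst e = P c j" by (auto simp: pre_digraph.cas.simps)
    then consider (dest) "e = (P c j, Dest)" "L \<le> c" "c \<le> U"
      | (step) x where "e = (P c j, P (c + 1) x)" "j < x" "x \<le> m" "P (c + 1) x \<in> muc_nodes m U"
      unfolding muc_arcs_def by fastforce
    then show ?case
    proof cases
      case dest
      \<comment> \<open>No arc starts at \<open>Dest\<close>, so nothing can follow.\<close>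
      have "p = []"
      proof (cases p)
        case (Cons e' q)
        with Cons.prems dest have "e' \<in> muc_arcs m L U" "fst e' = Dest"
          by (auto simp: pre_digraph.cas.simps)
        then show ?thesis by (auto simp: muc_arcs_def)
      qed
      with dest show ?thesis by (intro exI[of _ "[]"]) simp
    next
      case step
      then have "c + 1 \<le> U" by (auto simp: P_in_muc_nodes_iff)
      with Cons.IH[OF step(4)] Cons.prems step(1)
      obtain xs where "p = muc_walk (c + 1) x xs" "sorted_wrt (<) (x # xs)" "set xs \<subseteq> {..m}"
        "L \<le> c + 1 + length xs" "c + 1 + length xs \<le> U"
        by (auto simp: pre_digraph.cas.simps)
      with step show ?thesis by (intro exI[of _ "x # xs"]) auto
    qed
  qed
  with that show thesis by blast
qed

lemma muc_paths_eq:
  "muc_paths m L U = muc_walk 0 0 `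
     {xs. sorted_wrt (<) xs \<and> set xs \<subseteq> {1..m} \<and> L \<le> length xs \<and> length xs \<le> U}"
    (is "_ = _ ` ?X")
proof (intro equalityI subsetI)
  fix p assume "p \<in> muc_paths m L U"
  then have "pre_digraph.cas (muc_graph m L U) (P 0 0) p Dest" "set p \<subseteq> muc_arcs m L U"
    by (auto simp: muc_paths_def pre_digraph.apath_def pre_digraph.awalk_def muc_dag_def)
  then obtain xs where xs: "p = muc_walk 0 0 xs" "sorted_wrt (<) (0 # xs)" "set xs \<subseteq> {..m}"
    "L \<le> 0 + length xs" "0 + length xs \<le> U"
    by (rule muc_walk_if_cas[rotated 2]) (simp_all add: P_in_muc_nodes_iff)
  \<comment> \<open>The leading \<open>0\<close> of the sorted list makes all entries positive,
    which narrows \<open>{..m}\<close> to \<open>{1..m}\<close>.\<close>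
  then have "xs \<in> ?X" by (auto simp: Suc_le_eq)
  with xs(1) show "p \<in> muc_walk 0 0 ` ?X" by blast
next
  fix p assume "p \<in> muc_walk 0 0 ` ?X"
  then obtain xs where p: "p = muc_walk 0 0 xs" and xs: "xs \<in> ?X" by blast
  have node: "P 0 0 \<in> muc_nodes m U" by (simp add: P_in_muc_nodes_iff)
  have "set p \<subseteq> muc_arcs m L U"
    unfolding p using xs by (intro set_muc_walk_subset_arcs[OF node]) auto
  then show "p \<in> muc_paths m L U"
    using node cas_muc_walk distinct_muc_walk_verts
    by (simp add: p muc_paths_def pre_digraph.apath_def pre_digraph.awalk_def muc_dag_def)
qed

text \<open>Strict sortedness excludes repetitions, so length and cardinality agree, and
  \<open>sorted_list_of_set\<close> is the inverse.\<close>

lemma bij_betw_set_composite_alternatives: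
  "bij_betw set {xs. sorted_wrt (<) xs \<and> set xs \<subseteq> {1..m} \<and> L \<le> length xs \<and> length xs \<le> U}
     (composite_alternatives m L U)"
proof (rule bij_betw_byWitness[where f' = sorted_list_of_set])
  \<comment> \<open>Finiteness matters because \<open>sorted_list_of_set\<close> is
    \<open>[]\<close> on infinite sets.\<close>
  have "finite S" if "S \<in> composite_alternatives m L U" for S
    using that by (auto simp: composite_alternatives_def dest: finite_subset)
  then have set_sorted: "set (sorted_list_of_set S) = S" if "S \<in> composite_alternatives m L U" for S
    using that by simp
  then show "\<forall>S\<in>composite_alternatives m L U. set (sorted_list_of_set S) = S" by blast
  show "sorted_list_of_set ` composite_alternatives m L U
      \<subseteq> {xs. sorted_wrt (<) xs \<and> set xs \<subseteq> {1..m} \<and> L \<le> length xs \<and> length xs \<le> U}"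
  proof (rule image_subsetI)
    fix S assume S: "S \<in> composite_alternatives m L U"
    then show "sorted_list_of_set S
        \<in> {xs. sorted_wrt (<) xs \<and> set xs \<subseteq> {1..m} \<and> L \<le> length xs \<and> length xs \<le> U}"
      using set_sorted[OF S] by (simp add: composite_alternatives_def)
  qed
qed (auto simp: composite_alternatives_def strict_sorted_iff distinct_card
  sorted_list_of_set.idem_if_sorted_distinct)

theorem proposition4:
  fixes m L U :: nat
  assumes "1 \<le> L" and "L \<le> U" and "U \<le> m"
  shows "\<exists>f. bij_betw f (composite_alternatives m L U) (muc_paths m L U)"
proof -
  have "bij_betw (muc_walk 0 0)
      {xs. sorted_wrt (<) xs \<and> set xs \<subseteq> {1..m} \<and> L \<le> length xs \<and> length xs \<le> U}
      (muc_paths m L U)"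
    \<comment> \<open>With the paths written as an image, only injectivity remains.\<close>
    unfolding muc_paths_eq by (intro inj_on_imp_bij_betw inj_onI) (simp add: muc_walk_eq_iff)
  then show ?thesis
    using bij_betw_trans[OF bij_betw_inv_into[OF bij_betw_set_composite_alternatives]] by blast
qed

end
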